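(* If $\mathbf{A}$ is a residuated chain, $\mathbf{K}$ is a cancellative monoid and $\varphi:\mathbf{K}\to\mathbf{ResEnd}(\mathbf{A})$, $k\mapsto\varphi_k$, is a monoid homomorphism, then the bounded lattice-ordered monoid $\mathbf{A}\rtimes^b_\varphi\mathbf{K}$ is a residuated lattice (i.e., it is the reduct of a, necessarily unique, residuated lattice).
   Context: A residuated lattice is an algebra $(R,\wedge,\vee,\cdot,\backslash,/,1)$ such that $(R,\wedge,\vee)$ is a lattice, $(R,\cdot,1)$ is a monoid, and $xy\le z \iff y\le x\backslash z \iff x\le z/y$ for all $x,y,z$. A residuated chain is a residuated lattice whose order is total. A map $g:\mathbf{P}\to\mathbf{Q}$ between posets is residuated if there is $g^*:\mathbf{Q}\to\mathbf{P}$ with $g(x)\le y\iff x\le g^*(y)$ for all $x\in P$, $y\in Q$. $\mathbf{ResEnd}(\mathbf{A})$ is the monoid (under composition) of residuated maps on the chain $(A,\le)$ that are also endomorphisms of the monoid $(A,\cdot,1)$. $\mathbf{A}\rtimes^b_\varphi\mathbf{K}$ is the algebra on $R=(A\times K)\cup\{\bot,\top\}$ with multiplication on $A\times K$ given by $(a_1,k_1)\cdot(a_2,k_2)=(a_1\varphi_{k_1}(a_2),k_1k_2)$, identity $(1_{\mathbf{A}},1_{\mathbf{K}})$, $\bot x=x\bot=\bot$ for all $x\in R$ and $\top y=y\top=\top$ for all $y\neq\bot$; its order is given by $\bot\le x\le\top$ for all $x\in R$, and $(a_1,k_1)\le(a_2,k_2)$ iff $k_1=k_2$ and $a_1\le a_2$.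 *)

theory Defs
  imports "HOL-Algebra.Divisibility"
begin

record 'a ordered_monoid = "'a monoid" +
  leq :: "['a, 'a] \<Rightarrow> bool" (infixl \<open>\<preceq>\<index>\<close> 50)

definition order_of :: "('a, 'm) ordered_monoid_scheme \<Rightarrow> 'a gorder" where
  "order_of M = \<lparr>carrier = carrier M, eq = (=), le = leq M\<rparr>"

text \<open>The lattice operations are not separate record fields: meets and joins are those
  which the library derives from the order (\<^const>\<open>meet\<close> and \<^const>\<open>join\<close> of
  \<open>order_of R\<close>).  Hence the \<^typ>\<open>'a ordered_monoid\<close> part of a structure is its
  reduct without the two residuals.\<close>

record 'a residuated_monoid = "'a ordered_monoid" +
  lres :: "['a, 'a] \<Rightarrow> 'a"  \<comment> \<open>\<open>lres R x z\<close> is \<open>x\<close> under \<open>z\<close>\<close>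
  rres :: "['a, 'a] \<Rightarrow> 'a"  \<comment> \<open>\<open>rres R z y\<close> is \<open>z\<close> over \<open>y\<close>\<close>

locale residuated_lattice = monoid R + lattice "order_of R"
  for R :: "('a, 'm) residuated_monoid_scheme" (structure) +
  assumes lres_closed: "\<lbrakk>x \<in> carrier R; z \<in> carrier R\<rbrakk> \<Longrightarrow> lres R x z \<in> carrier R"
    and rres_closed: "\<lbrakk>z \<in> carrier R; y \<in> carrier R\<rbrakk> \<Longrightarrow> rres R z y \<in> carrier R"
    and lres_iff: "\<lbrakk>x \<in> carrier R; y \<in> carrier R; z \<in> carrier R\<rbrakk>
      \<Longrightarrow> x \<otimes> y \<preceq> z \<longleftrightarrow> y \<preceq> lres R x z"
    and rres_iff: "\<lbrakk>x \<in> carrier R; y \<in> carrier R; z \<in> carrier R\<rbrakk>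
      \<Longrightarrow> x \<otimes> y \<preceq> z \<longleftrightarrow> x \<preceq> rres R z y"

locale residuated_chain = residuated_lattice R + total_order "order_of R"
  for R :: "('a, 'm) residuated_monoid_scheme" (structure)

definition residuated_map :: "'a gorder \<Rightarrow> 'b gorder \<Rightarrow> ('a \<Rightarrow> 'b) \<Rightarrow> bool" where
  "residuated_map P Q g \<longleftrightarrow> g \<in> carrier P \<rightarrow> carrier Q \<and>
     (\<exists>h \<in> carrier Q \<rightarrow> carrier P. \<forall>x \<in> carrier P. \<forall>y \<in> carrier Q.
        g x \<sqsubseteq>\<^bsub>Q\<^esub> y \<longleftrightarrow> x \<sqsubseteq>\<^bsub>P\<^esub> h y)"

text \<open>The library's \<^const>\<open>hom\<close> does not require preservation of the unit.\<close>

definition monoid_hom :: "('a, 'm) monoid_scheme \<Rightarrow> ('b, 'n) monoid_scheme \<Rightarrow> ('a \<Rightarrow> 'b) set" where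
  "monoid_hom G H = {f \<in> hom G H. f \<one>\<^bsub>G\<^esub> = \<one>\<^bsub>H\<^esub>}"

text \<open>Maps on the carrier are represented by extensional functions, so that equality in
  \<open>ResEnd A\<close> is equality on \<open>carrier A\<close>.\<close>

definition ResEnd :: "('a, 'm) ordered_monoid_scheme \<Rightarrow> ('a \<Rightarrow> 'a) monoid" where
  "ResEnd A =
     \<lparr>carrier = {g \<in> extensional (carrier A).
                  residuated_map (order_of A) (order_of A) g \<and> g \<in> monoid_hom A A},
      mult = compose (carrier A),
      one = (\<lambda>x \<in> carrier A. x)\<rparr>"

datatype 'a bounded = Bot | Elem 'a | Top

fun sdp_mult ::
  "('a, 'm) ordered_monoid_scheme \<Rightarrow> ('k, 'n) monoid_scheme \<Rightarrow> ('k \<Rightarrow> 'a \<Rightarrow> 'a)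
    \<Rightarrow> ('a \<times> 'k) bounded \<Rightarrow> ('a \<times> 'k) bounded \<Rightarrow> ('a \<times> 'k) bounded" where
  "sdp_mult A K \<phi> Bot y = Bot"
| "sdp_mult A K \<phi> x Bot = Bot"
| "sdp_mult A K \<phi> Top y = Top"
| "sdp_mult A K \<phi> x Top = Top"
| "sdp_mult A K \<phi> (Elem (a\<^sub>1, k\<^sub>1)) (Elem (a\<^sub>2, k\<^sub>2)) =
     Elem (a\<^sub>1 \<otimes>\<^bsub>A\<^esub> \<phi> k\<^sub>1 a\<^sub>2, k\<^sub>1 \<otimes>\<^bsub>K\<^esub> k\<^sub>2)"

fun sdp_leq ::
  "('a, 'm) ordered_monoid_scheme \<Rightarrow> ('a \<times> 'k) bounded \<Rightarrow> ('a \<times> 'k) bounded \<Rightarrow> bool" where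
  "sdp_leq A Bot y = True"
| "sdp_leq A x Top = True"
| "sdp_leq A (Elem (a\<^sub>1, k\<^sub>1)) (Elem (a\<^sub>2, k\<^sub>2)) = (k\<^sub>1 = k\<^sub>2 \<and> a\<^sub>1 \<preceq>\<^bsub>A\<^esub> a\<^sub>2)"
| "sdp_leq A x y = False"

definition bounded_semidirect_product ::
  "('a, 'm) ordered_monoid_scheme \<Rightarrow> ('k, 'n) monoid_scheme \<Rightarrow> ('k \<Rightarrow> 'a \<Rightarrow> 'a)
    \<Rightarrow> ('a \<times> 'k) bounded ordered_monoid" where
  "bounded_semidirect_product A K \<phi> =
     \<lparr>carrier = Elem ` (carrier A \<times> carrier K) \<union> {Bot, Top},
      mult = sdp_mult A K \<phi>,
      one = Elem (\<one>\<^bsub>A\<^esub>, \<one>\<^bsub>K\<^esub>),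
      leq = sdp_leq A\<rparr>"

end

theory Submission
  imports Defs
begin

text \<open>
  Let \<open>P\<close> be the bounded semidirect product.  Residuals are not part of \<open>P\<close>, but the left
  residual of \<open>x\<close> and \<open>z\<close> can only be the greatest \<open>y\<close> with \<open>x \<otimes> y \<preceq> z\<close>, and dually for the right
  one.  So residuals are unique by antisymmetry, and they exist as operations as soon as these
  greatest elements exist separately for every pair (\<open>residuated_expansion_ex_unique\<close>).

  Two features of \<open>P\<close> make the greatest elements exist.  The fibres \<open>A \<times> {k}\<close> are chains and
  elements of different fibres are bounded only by \<open>Bot\<close> and \<open>Top\<close>; hence incomparable elements
  have meet \<open>Bot\<close> and join \<open>Top\<close>, and \<open>P\<close> is a lattice (\<open>lattice_product\<close>).  And since \<open>K\<close> is
  cancellative, for given \<open>k\<close> and \<open>n\<close> at most one fibre \<open>l\<close> solves \<open>k \<otimes> l = n\<close>.  If there is none,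
  only \<open>Bot\<close> multiplies \<open>(a, k)\<close> below \<open>(c, n)\<close>.  If there is one, the solutions \<open>(b, l)\<close> are those
  with \<open>a \<otimes> \<phi> k b \<preceq> c\<close>, and residuating first in \<open>A\<close> and then along \<open>\<phi> k\<close> yields the largest
  such \<open>b\<close>.  On the other side the action falls on the known factor, and the residual of \<open>A\<close>
  suffices.
\<close>

section \<open>From greatest solutions to residuals\<close>

lemma order_of_simps [simp]:
  "carrier (order_of M) = carrier M" "le (order_of M) = leq M" "eq (order_of M) = (=)"
  by (simp_all add: order_of_def)

text \<open>The residuals are obtained by choosing, for each pair, an element that represents the
  solutions of the inequality; antisymmetry leaves no freedom in this choice.\<close>

lemma residuated_expansion_ex_unique:
  fixes M :: "'a ordered_monoid"
  assumes "monoid M" and "lattice (order_of M)"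
    and left: "\<And>x z. \<lbrakk>x \<in> carrier M; z \<in> carrier M\<rbrakk> \<Longrightarrow>
      \<exists>w \<in> carrier M. \<forall>y \<in> carrier M. x \<otimes>\<^bsub>M\<^esub> y \<preceq>\<^bsub>M\<^esub> z \<longleftrightarrow> y \<preceq>\<^bsub>M\<^esub> w"
    and right: "\<And>z y. \<lbrakk>z \<in> carrier M; y \<in> carrier M\<rbrakk> \<Longrightarrow>
      \<exists>w \<in> carrier M. \<forall>x \<in> carrier M. x \<otimes>\<^bsub>M\<^esub> y \<preceq>\<^bsub>M\<^esub> z \<longleftrightarrow> x \<preceq>\<^bsub>M\<^esub> w"
  shows "\<exists>R :: 'a residuated_monoid.
    residuated_lattice R \<and> ordered_monoid.truncate R = M \<and>
    (\<forall>R' :: 'a residuated_monoid.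
      residuated_lattice R' \<and> ordered_monoid.truncate R' = M \<longrightarrow>
      (\<forall>x \<in> carrier R. \<forall>y \<in> carrier R.
        lres R' x y = lres R x y \<and> rres R' x y = rres R x y))"
proof -
  interpret M: lattice "order_of M" by fact
  obtain l where l: "\<And>x z. \<lbrakk>x \<in> carrier M; z \<in> carrier M\<rbrakk> \<Longrightarrow> l x z \<in> carrier M \<and>
      (\<forall>y \<in> carrier M. x \<otimes>\<^bsub>M\<^esub> y \<preceq>\<^bsub>M\<^esub> z \<longleftrightarrow> y \<preceq>\<^bsub>M\<^esub> l x z)"
    using left by metis
  obtain r where r: "\<And>z y. \<lbrakk>z \<in> carrier M; y \<in> carrier M\<rbrakk> \<Longrightarrow> r z y \<in> carrier M \<and>
      (\<forall>x \<in> carrier M. x \<otimes>\<^bsub>M\<^esub> y \<preceq>\<^bsub>M\<^esub> z \<longleftrightarrow> x \<preceq>\<^bsub>M\<^esub> r z y)"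
    using right by metis
  define R :: "'a residuated_monoid" where
    "R = \<lparr>carrier = carrier M, mult = mult M, one = one M, leq = leq M, lres = l, rres = r\<rparr>"
  have R_simps: "carrier R = carrier M" "mult R = mult M" "one R = one M" "leq R = leq M"
    "lres R = l" "rres R = r"
    by (simp_all add: R_def)
  have trunc: "ordered_monoid.truncate R = M"
    by (simp add: R_def ordered_monoid.truncate_def)
  have "monoid R"
    using \<open>monoid M\<close> unfolding monoid_def R_simps .
  moreover have "lattice (order_of R)"
    using \<open>lattice (order_of M)\<close> by (simp add: order_of_def R_simps)
  moreover have "residuated_lattice_axioms R"
    unfolding residuated_lattice_axioms_def R_simps using l r by blast
  ultimately have R: "residuated_lattice R"
    by (rule residuated_lattice.intro)
  have greatest_unique: "v = w" if "v \<in> carrier M" "w \<in> carrier M"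
    "\<And>u. u \<in> carrier M \<Longrightarrow> u \<preceq>\<^bsub>M\<^esub> v \<longleftrightarrow> u \<preceq>\<^bsub>M\<^esub> w" for v w
    using that M.le_antisym[of v w] M.le_refl[of v] M.le_refl[of w] by simp
  have "lres R' x y = l x y \<and> rres R' x y = r x y"
    if "residuated_lattice R'" and R': "ordered_monoid.truncate R' = M"
      and xy: "x \<in> carrier M" "y \<in> carrier M" for R' :: "'a residuated_monoid" and x y
  proof -
    interpret R': residuated_lattice R' by fact
    have R'_simps: "carrier R' = carrier M" "mult R' = mult M" "leq R' = leq M"
      using R' by (auto simp: ordered_monoid.truncate_def)
    show ?thesis
      using xy l r R'.lres_closed R'.rres_closed R'.lres_iff R'.rres_iff
      unfolding R'_simps by (auto intro!: greatest_unique)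
  qed
  with R trunc show ?thesis
    by (intro exI[of _ R]) (simp add: R_simps)
qed

section \<open>The bounded semidirect product\<close>

locale residuated_chain_action =
  A: residuated_chain A + K: monoid_cancel K
  for A :: "('a, 'm) residuated_monoid_scheme" and K :: "('k, 'n) monoid_scheme"
    and \<phi> :: "'k \<Rightarrow> 'a \<Rightarrow> 'a" +
  assumes action: "\<phi> \<in> monoid_hom K (ResEnd A)"
begin

abbreviation product :: "('a \<times> 'k) bounded ordered_monoid" where
  "product \<equiv> bounded_semidirect_product A K \<phi>"

lemma product_simps:
  "carrier product = Elem ` (carrier A \<times> carrier K) \<union> {Bot, Top}"
  "mult product = sdp_mult A K \<phi>"
  "one product = Elem (\<one>\<^bsub>A\<^esub>, \<one>\<^bsub>K\<^esub>)"
  "leq product = sdp_leq A"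
  by (simp_all add: bounded_semidirect_product_def)

lemma product_cases [consumes 1, case_names Bot Elem Top]:
  assumes "x \<in> carrier product"
  obtains "x = Bot"
  | a k where "x = Elem (a, k)" "a \<in> carrier A" "k \<in> carrier K"
  | "x = Top"
  using assms by (auto simp: product_simps)

lemma product_ball:
  "(\<forall>x \<in> carrier product. Q x) \<longleftrightarrow>
     Q Bot \<and> Q Top \<and> (\<forall>a \<in> carrier A. \<forall>k \<in> carrier K. Q (Elem (a, k)))"
  by (auto simp: product_simps)

text \<open>The recursion equations distinguish the shapes of both arguments at once; these rules
  evaluate a bound in one argument whatever the other one is.\<close>

lemma sdp_leq_simps [simp]:
  "sdp_leq A x Top" "sdp_leq A x Bot \<longleftrightarrow> x = Bot" "sdp_leq A Top x \<longleftrightarrow> x = Top"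
  by (cases x; simp)+

lemma sdp_mult_simps [simp]:
  "sdp_mult A K \<phi> x Bot = Bot"
  "sdp_mult A K \<phi> Top x = (if x = Bot then Bot else Top)"
  "sdp_mult A K \<phi> x Top = (if x = Bot then Bot else Top)"
  by (cases x; simp)+

lemma action_ResEnd: "k \<in> carrier K \<Longrightarrow> \<phi> k \<in> carrier (ResEnd A)"
  using action by (auto simp: monoid_hom_def hom_def)

lemma action_closed [simp]:
  "\<lbrakk>k \<in> carrier K; a \<in> carrier A\<rbrakk> \<Longrightarrow> \<phi> k a \<in> carrier A"
  using action_ResEnd[of k] by (auto simp: ResEnd_def monoid_hom_def hom_def)

lemma action_mult:
  "\<lbrakk>k \<in> carrier K; a \<in> carrier A; b \<in> carrier A\<rbrakk> \<Longrightarrow>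
     \<phi> k (a \<otimes>\<^bsub>A\<^esub> b) = \<phi> k a \<otimes>\<^bsub>A\<^esub> \<phi> k b"
  using action_ResEnd[of k] by (auto simp: ResEnd_def monoid_hom_def hom_def)

lemma action_one: "k \<in> carrier K \<Longrightarrow> \<phi> k \<one>\<^bsub>A\<^esub> = \<one>\<^bsub>A\<^esub>"
  using action_ResEnd[of k] by (auto simp: ResEnd_def monoid_hom_def)

lemma one_action: "a \<in> carrier A \<Longrightarrow> \<phi> \<one>\<^bsub>K\<^esub> a = a"
  using action by (auto simp: monoid_hom_def ResEnd_def)

lemma mult_action:
  "\<lbrakk>k \<in> carrier K; l \<in> carrier K; a \<in> carrier A\<rbrakk> \<Longrightarrow> \<phi> (k \<otimes>\<^bsub>K\<^esub> l) a = \<phi> k (\<phi> l a)"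
  using action by (auto simp: monoid_hom_def hom_def ResEnd_def compose_def)

lemma action_residual:
  assumes "k \<in> carrier K"
  obtains h where "\<And>a. a \<in> carrier A \<Longrightarrow> h a \<in> carrier A"
    and "\<And>a b. \<lbrakk>a \<in> carrier A; b \<in> carrier A\<rbrakk> \<Longrightarrow> \<phi> k a \<preceq>\<^bsub>A\<^esub> b \<longleftrightarrow> a \<preceq>\<^bsub>A\<^esub> h b"
proof -
  have "residuated_map (order_of A) (order_of A) (\<phi> k)"
    using action_ResEnd[OF assms] by (simp add: ResEnd_def)
  then obtain h where "h \<in> carrier A \<rightarrow> carrier A"
    "\<forall>a \<in> carrier A. \<forall>b \<in> carrier A. \<phi> k a \<preceq>\<^bsub>A\<^esub> b \<longleftrightarrow> a \<preceq>\<^bsub>A\<^esub> h b"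
    by (auto simp: residuated_map_def)
  then show thesis
    by (intro that[of h]) auto
qed

lemma monoid_product: "monoid product"
proof (rule monoidI)
  show "x \<otimes>\<^bsub>product\<^esub> y \<in> carrier product"
    if "x \<in> carrier product" "y \<in> carrier product" for x y
    using that by (auto simp: product_simps)
  show "\<one>\<^bsub>product\<^esub> \<in> carrier product"
    by (auto simp: product_simps)
  show "x \<otimes>\<^bsub>product\<^esub> y \<otimes>\<^bsub>product\<^esub> z = x \<otimes>\<^bsub>product\<^esub> (y \<otimes>\<^bsub>product\<^esub> z)"
    if "x \<in> carrier product" "y \<in> carrier product" "z \<in> carrier product" for x y z
    using that
    by (elim product_cases)
      (simp_all add: product_simps(2) action_mult mult_action A.m_assoc K.m_assoc)
  show "\<one>\<^bsub>product\<^esub> \<otimes>\<^bsub>product\<^esub> x = x" if "x \<in> carrier product" for x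
    using that by (cases x rule: product_cases) (simp_all add: product_simps(2,3) one_action)
  show "x \<otimes>\<^bsub>product\<^esub> \<one>\<^bsub>product\<^esub> = x" if "x \<in> carrier product" for x
    using that by (cases x rule: product_cases) (simp_all add: product_simps(2,3) action_one)
qed

lemma partial_order_product: "partial_order (order_of product)"
proof unfold_locales
  fix x y z
  assume "x \<in> carrier (order_of product)" "y \<in> carrier (order_of product)"
    "z \<in> carrier (order_of product)" "x \<sqsubseteq>\<^bsub>order_of product\<^esub> y" "y \<sqsubseteq>\<^bsub>order_of product\<^esub> z"
  then show "x \<sqsubseteq>\<^bsub>order_of product\<^esub> z"
    using A.le_trans by (auto simp: product_simps)
qed (use A.le_refl A.le_antisym in \<open>auto simp: product_simps\<close>)

text \<open>Comparable elements trivially have a meet and a join.  Incomparable ones lie in different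
  fibres because each fibre is a chain, and no element of a fibre bounds two fibres.\<close>

lemma lattice_product: "lattice (order_of product)"
proof -
  interpret P: partial_order "order_of product" by (rule partial_order_product)
  have bounds_of_incomparable:
    "(x \<sqsubseteq>\<^bsub>order_of product\<^esub> u \<and> y \<sqsubseteq>\<^bsub>order_of product\<^esub> u \<longrightarrow> u = Top) \<and>
     (u \<sqsubseteq>\<^bsub>order_of product\<^esub> x \<and> u \<sqsubseteq>\<^bsub>order_of product\<^esub> y \<longrightarrow> u = Bot)"
    if "x \<in> carrier product" "y \<in> carrier product" "u \<in> carrier product"
      "\<not> x \<sqsubseteq>\<^bsub>order_of product\<^esub> y" "\<not> y \<sqsubseteq>\<^bsub>order_of product\<^esub> x" for x y u
    using that A.total_order_total by (fastforce simp: product_simps)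
  have bounds: "Bot \<in> carrier product" "Top \<in> carrier product"
    "Bot \<sqsubseteq>\<^bsub>order_of product\<^esub> x" "x \<sqsubseteq>\<^bsub>order_of product\<^esub> Top" for x
    by (auto simp: product_simps)
  show ?thesis
  proof unfold_locales
    fix x y assume xy: "x \<in> carrier (order_of product)" "y \<in> carrier (order_of product)"
    consider "x \<sqsubseteq>\<^bsub>order_of product\<^esub> y" | "y \<sqsubseteq>\<^bsub>order_of product\<^esub> x"
      | "\<not> x \<sqsubseteq>\<^bsub>order_of product\<^esub> y" "\<not> y \<sqsubseteq>\<^bsub>order_of product\<^esub> x"
      by blast
    note comparability = this
    show "\<exists>s. least (order_of product) s (Upper (order_of product) {x, y})"
    proof (cases rule: comparability)
      case 1
      with xy P.le_refl[of y] show ?thesis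
        by (intro exI[of _ y]) (auto simp: least_def Upper_def)
    next
      case 2
      with xy P.le_refl[of x] show ?thesis
        by (intro exI[of _ x]) (auto simp: least_def Upper_def)
    next
      case 3
      with xy bounds bounds_of_incomparable[of x y] show ?thesis
        by (intro exI[of _ Top]) (auto simp: least_def Upper_def)
    qed
    show "\<exists>s. greatest (order_of product) s (Lower (order_of product) {x, y})"
    proof (cases rule: comparability)
      case 1
      with xy P.le_refl[of x] show ?thesis
        by (intro exI[of _ x]) (auto simp: greatest_def Lower_def)
    next
      case 2
      with xy P.le_refl[of y] show ?thesis
        by (intro exI[of _ y]) (auto simp: greatest_def Lower_def)
    next
      case 3
      with xy bounds bounds_of_incomparable[of x y] show ?thesis
        by (intro exI[of _ Bot]) (auto simp: greatest_def Lower_def)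
    qed
  qed
qed

text \<open>Left cancellation confines the solutions between \<open>Bot\<close> and \<open>Top\<close> to one fibre, where the
  inequality \<open>a \<otimes> \<phi> k b \<preceq> c\<close> is solved by applying the residual of \<open>\<phi> k\<close> to that of \<open>A\<close>.\<close>

lemma left_residual_ex:
  assumes "x \<in> carrier product" "z \<in> carrier product"
  shows "\<exists>w \<in> carrier product. \<forall>y \<in> carrier product.
    x \<otimes>\<^bsub>product\<^esub> y \<preceq>\<^bsub>product\<^esub> z \<longleftrightarrow> y \<preceq>\<^bsub>product\<^esub> w"
  using assms(1)
proof (cases x rule: product_cases)
  case Bot
  then show ?thesis
    by (intro bexI[of _ Top]) (auto simp: product_simps)
next
  case Top
  then show ?thesis
    by (intro bexI[of _ "if z = Top then Top else Bot"]) (auto simp: product_simps)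
next
  case x: (Elem a k)
  from assms(2) show ?thesis
  proof (cases z rule: product_cases)
    case Bot
    with x show ?thesis
      by (intro bexI[of _ Bot]) (auto simp: product_simps)
  next
    case Top
    then show ?thesis
      by (intro bexI[of _ Top]) (auto simp: product_simps)
  next
    case z: (Elem c n)
    show ?thesis
    proof (cases "\<exists>l \<in> carrier K. k \<otimes>\<^bsub>K\<^esub> l = n")
      case False
      with x z show ?thesis
        by (intro bexI[of _ Bot]) (auto simp: product_simps)
    next
      case True
      then obtain l where l: "l \<in> carrier K" "k \<otimes>\<^bsub>K\<^esub> l = n" by blast
      obtain h where h: "\<And>a. a \<in> carrier A \<Longrightarrow> h a \<in> carrier A"
        "\<And>a b. \<lbrakk>a \<in> carrier A; b \<in> carrier A\<rbrakk> \<Longrightarrow> \<phi> k a \<preceq>\<^bsub>A\<^esub> b \<longleftrightarrow> a \<preceq>\<^bsub>A\<^esub> h b"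
        using action_residual x(3) by blast
      have fibre: "k \<otimes>\<^bsub>K\<^esub> m = n \<longleftrightarrow> m = l" if "m \<in> carrier K" for m
        using that l x(3) K.l_cancel by blast
      have "a \<otimes>\<^bsub>A\<^esub> \<phi> k b \<preceq>\<^bsub>A\<^esub> c \<longleftrightarrow> b \<preceq>\<^bsub>A\<^esub> h (lres A a c)" if "b \<in> carrier A" for b
        using that x z h by (simp add: A.lres_iff A.lres_closed)
      with x z l h fibre show ?thesis
        by (intro bexI[of _ "Elem (h (lres A a c), l)"])
          (auto simp: product_ball product_simps A.lres_closed)
    qed
  qed
qed

text \<open>Here right cancellation determines the fibre, and the action is applied to the
  known factor, so residuating in \<open>A\<close> alone solves \<open>a \<otimes> \<phi> k b \<preceq> c\<close> for \<open>a\<close>.\<close>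

lemma right_residual_ex:
  assumes "z \<in> carrier product" "y \<in> carrier product"
  shows "\<exists>w \<in> carrier product. \<forall>x \<in> carrier product.
    x \<otimes>\<^bsub>product\<^esub> y \<preceq>\<^bsub>product\<^esub> z \<longleftrightarrow> x \<preceq>\<^bsub>product\<^esub> w"
  using assms(2)
proof (cases y rule: product_cases)
  case Bot
  then show ?thesis
    by (intro bexI[of _ Top]) (auto simp: product_simps)
next
  case Top
  then show ?thesis
    by (intro bexI[of _ "if z = Top then Top else Bot"]) (auto simp: product_simps)
next
  case y: (Elem b l)
  from assms(1) show ?thesis
  proof (cases z rule: product_cases)
    case Bot
    with y show ?thesis
      by (intro bexI[of _ Bot]) (auto simp: product_simps)
  next
    case Top
    then show ?thesis
      by (intro bexI[of _ Top]) (auto simp: product_simps)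
  next
    case z: (Elem c n)
    show ?thesis
    proof (cases "\<exists>k \<in> carrier K. k \<otimes>\<^bsub>K\<^esub> l = n")
      case False
      with y z show ?thesis
        by (intro bexI[of _ Bot]) (auto simp: product_simps)
    next
      case True
      then obtain k where k: "k \<in> carrier K" "k \<otimes>\<^bsub>K\<^esub> l = n" by blast
      have fibre: "m \<otimes>\<^bsub>K\<^esub> l = n \<longleftrightarrow> m = k" if "m \<in> carrier K" for m
        using that k y(3) K.r_cancel by blast
      have "a \<otimes>\<^bsub>A\<^esub> \<phi> k b \<preceq>\<^bsub>A\<^esub> c \<longleftrightarrow> a \<preceq>\<^bsub>A\<^esub> rres A c (\<phi> k b)" if "a \<in> carrier A" for a
        using that y z k by (simp add: A.rres_iff)
      with y z k fibre show ?thesis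
        by (intro bexI[of _ "Elem (rres A c (\<phi> k b), k)"])
          (auto simp: product_ball product_simps A.rres_closed)
    qed
  qed
qed

end

section \<open>The residuated lattice\<close>

theorem theorem6p6:
  fixes A :: "('a, 'm) residuated_monoid_scheme"
    and K :: "('k, 'n) monoid_scheme"
    and \<phi> :: "'k \<Rightarrow> 'a \<Rightarrow> 'a"
  assumes "residuated_chain A"
    and "monoid_cancel K"
    and "\<phi> \<in> monoid_hom K (ResEnd A)"
  shows "\<exists>R :: ('a \<times> 'k) bounded residuated_monoid.
    residuated_lattice R \<and>
    ordered_monoid.truncate R = bounded_semidirect_product A K \<phi> \<and>
    (\<forall>R' :: ('a \<times> 'k) bounded residuated_monoid.
      residuated_lattice R' \<and>
      ordered_monoid.truncate R' = bounded_semidirect_product A K \<phi> \<longrightarrow>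
      (\<forall>x \<in> carrier R. \<forall>y \<in> carrier R.
        lres R' x y = lres R x y \<and> rres R' x y = rres R x y))"
proof -
  interpret residuated_chain_action A K \<phi>
    using assms by (simp add: residuated_chain_action_def residuated_chain_action_axioms_def)
  show ?thesis
    by (rule residuated_expansion_ex_unique
        [OF monoid_product lattice_product left_residual_ex right_residual_ex])
qed

end
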